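(* Let $\mathcal{H}$ be a complex Hilbert space with identity operator $I$, let $m,M\in\mathbb{R}$, and let $A,B$ be invertible positive bounded operators on $\mathcal{H}$ with $0<mI\leq A\leq MI$ and $0<mI\leq B\leq MI$. Put $h=\frac{M}{m}$ and assume $h>1$. Then for every $\nu\in[0,1]$, with $r=\min\{\nu,1-\nu\}$, $$S(\sqrt{h})\,A\sharp_{\nu}B\;\geq\;(1-\nu)A+\nu B-2r\left(\frac{A+B}{2}-A\sharp_{1/2}B\right).$$
   Context: A self-adjoint bounded operator $A$ on a complex Hilbert space $\mathcal{H}$ is called positive if $\langle x,Ax\rangle\geq 0$ for all $x\in\mathcal{H}$. For self-adjoint $A,B$, $A\geq B$ means that $A-B$ is positive; $0<mI$ means $m>0$. For invertible positive operators $A,B$ and $\nu\in[0,1]$, $A\sharp_{\nu}B := A^{1/2}\left(A^{-1/2}BA^{-1/2}\right)^{\nu}A^{1/2}$, with powers defined by the continuous functional calculus. Specht's ratio is defined for positive real $h\neq 1$ by $$S(h):=\frac{h^{\frac{1}{h-1}}}{e\log\left(h^{\frac{1}{h-1}}\right)}.$$ *)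

theory Defs
  imports "HOL-Analysis.Analysis" "HOL-Computational_Algebra.Polynomial"
begin

text \<open>
  Complex Hilbert spaces. The inner product is linear in its second argument, and the norm is
  the one induced by it; completeness is part of the superclass \<^class>\<open>banach\<close>.
  The trivial space is not excluded.
\<close>

class chilbert_space = banach +
  fixes scaleC :: "complex \<Rightarrow> 'a \<Rightarrow> 'a" (infixr "*\<^sub>C" 75)
    and cinner :: "'a \<Rightarrow> 'a \<Rightarrow> complex"
  assumes scaleC_add_right: "c *\<^sub>C (x + y) = c *\<^sub>C x + c *\<^sub>C y"
    and scaleC_add_left: "(c + d) *\<^sub>C x = c *\<^sub>C x + d *\<^sub>C x"
    and scaleC_scaleC: "c *\<^sub>C (d *\<^sub>C x) = (c * d) *\<^sub>C x"
    and scaleC_one: "1 *\<^sub>C x = x"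
    and scaleC_of_real: "complex_of_real s *\<^sub>C x = s *\<^sub>R x"
    and cinner_commute: "cinner x y = cnj (cinner y x)"
    and cinner_add_right: "cinner x (y + z) = cinner x y + cinner x z"
    and cinner_scaleC_right: "cinner x (c *\<^sub>C y) = c * cinner x y"
    and cinner_self: "cinner x x = complex_of_real ((norm x)\<^sup>2)"

text \<open>
  The type \<^typ>\<open>'a \<Rightarrow>\<^sub>L 'a\<close> consists of the bounded real-linear maps. The bounded operators on the
  complex space are those that also commute with complex scalars; their operator norm is the same.
\<close>

definition complex_linear_op :: "('a::chilbert_space \<Rightarrow>\<^sub>L 'a) \<Rightarrow> bool" where
  "complex_linear_op A \<longleftrightarrow>
     (\<forall>c x. blinfun_apply A (c *\<^sub>C x) = c *\<^sub>C blinfun_apply A x)"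

definition selfadjoint_op :: "('a::chilbert_space \<Rightarrow>\<^sub>L 'a) \<Rightarrow> bool" where
  "selfadjoint_op A \<longleftrightarrow> complex_linear_op A \<and>
     (\<forall>x y. cinner (blinfun_apply A x) y = cinner x (blinfun_apply A y))"

definition positive_op :: "('a::chilbert_space \<Rightarrow>\<^sub>L 'a) \<Rightarrow> bool" where
  "positive_op A \<longleftrightarrow> selfadjoint_op A \<and>
     (\<forall>x. cinner x (blinfun_apply A x) \<in> \<real>\<^sub>\<ge>\<^sub>0)"

definition op_ge :: "('a::chilbert_space \<Rightarrow>\<^sub>L 'a) \<Rightarrow> ('a \<Rightarrow>\<^sub>L 'a) \<Rightarrow> bool"
    (infix "\<succeq>" 50) where
  "A \<succeq> B \<longleftrightarrow> selfadjoint_op A \<and> selfadjoint_op B \<and> positive_op (A - B)"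

definition invertible_op :: "('a::chilbert_space \<Rightarrow>\<^sub>L 'a) \<Rightarrow> bool" where
  "invertible_op A \<longleftrightarrow> complex_linear_op A \<and>
     (\<exists>B. complex_linear_op B \<and> A o\<^sub>L B = id_blinfun \<and> B o\<^sub>L A = id_blinfun)"

lemma bounded_linear_scaleC: "bounded_linear (\<lambda>x::'a::chilbert_space. c *\<^sub>C x)"
proof (rule bounded_linear_intro[where K = "cmod c"])
  fix x y :: 'a and s :: real
  show "c *\<^sub>C (x + y) = c *\<^sub>C x + c *\<^sub>C y" by (rule scaleC_add_right)
  show "c *\<^sub>C (s *\<^sub>R x) = s *\<^sub>R (c *\<^sub>C x)"
    by (simp add: scaleC_of_real[symmetric] scaleC_scaleC mult.commute)
  have "cinner (c *\<^sub>C x) (c *\<^sub>C x) = c * cnj (cinner x (c *\<^sub>C x))"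
    by (metis cinner_scaleC_right cinner_commute)
  also have "\<dots> = c * cnj c * complex_of_real ((norm x)\<^sup>2)"
    by (simp add: cinner_scaleC_right cinner_self)
  also have "\<dots> = complex_of_real ((cmod c * norm x)\<^sup>2)"
    by (simp add: complex_norm_square[symmetric] power_mult_distrib del: of_real_power)
  finally have "(norm (c *\<^sub>C x))\<^sup>2 = (cmod c * norm x)\<^sup>2"
    by (simp only: cinner_self of_real_eq_iff)
  then show "norm (c *\<^sub>C x) \<le> norm x * cmod c"
    by (simp add: mult.commute)
qed

definition scalar_op :: "complex \<Rightarrow> ('a::chilbert_space \<Rightarrow>\<^sub>L 'a)" where
  "scalar_op c = Blinfun (\<lambda>x. c *\<^sub>C x)"

lemma scalar_op_apply: "blinfun_apply (scalar_op c) x = c *\<^sub>C x"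
  by (simp add: scalar_op_def bounded_linear_Blinfun_apply bounded_linear_scaleC)

definition op_spectrum :: "('a::chilbert_space \<Rightarrow>\<^sub>L 'a) \<Rightarrow> complex set" where
  "op_spectrum A = {z. \<not> invertible_op (A - scalar_op z)}"

definition op_poly :: "real poly \<Rightarrow> ('a::chilbert_space \<Rightarrow>\<^sub>L 'a) \<Rightarrow> ('a \<Rightarrow>\<^sub>L 'a)" where
  "op_poly p A = (\<Sum>i\<le>degree p. coeff p i *\<^sub>R (((o\<^sub>L) A ^^ i) id_blinfun))"

text \<open>
  Continuous functional calculus of a self-adjoint operator: \<open>f(A)\<close> is the norm limit of \<open>p\<^sub>n(A)\<close>
  for any polynomials \<open>p\<^sub>n\<close> converging to \<open>f\<close> uniformly on the spectrum. The spectrum of a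
  self-adjoint operator is real, so for real-valued \<open>f\<close> real polynomials suffice. The value is
  meaningful only if \<open>A\<close> is self-adjoint and \<open>f\<close> is continuous on the spectrum; then such
  polynomials exist by the Weierstrass theorem, and the limit does not depend on their choice.
\<close>

definition cfc :: "(real \<Rightarrow> real) \<Rightarrow> ('a::chilbert_space \<Rightarrow>\<^sub>L 'a) \<Rightarrow> ('a \<Rightarrow>\<^sub>L 'a)" where
  "cfc f A = (THE T. \<exists>p :: nat \<Rightarrow> real poly.
     uniform_limit {t. complex_of_real t \<in> op_spectrum A} (\<lambda>n. poly (p n)) f sequentially \<and>
     (\<lambda>n. op_poly (p n) A) \<longlonglongrightarrow> T)"

text \<open>
  Powers are used for invertible positive operators only, whose spectrum lies in the positive
  reals; there \<^term>\<open>\<lambda>t::real. t powr s\<close> is continuous for every real \<open>s\<close>.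
\<close>

definition op_powr :: "('a::chilbert_space \<Rightarrow>\<^sub>L 'a) \<Rightarrow> real \<Rightarrow> ('a \<Rightarrow>\<^sub>L 'a)" where
  "op_powr A s = cfc (\<lambda>t. t powr s) A"

definition geom_mean :: "real \<Rightarrow> ('a::chilbert_space \<Rightarrow>\<^sub>L 'a) \<Rightarrow> ('a \<Rightarrow>\<^sub>L 'a) \<Rightarrow> ('a \<Rightarrow>\<^sub>L 'a)" where
  "geom_mean \<nu> A B =
     op_powr A (1/2) o\<^sub>L op_powr (op_powr A (-1/2) o\<^sub>L B o\<^sub>L op_powr A (-1/2)) \<nu> o\<^sub>L op_powr A (1/2)"

definition specht_ratio :: "real \<Rightarrow> real" where
  "specht_ratio h = h powr (1 / (h - 1)) / (exp 1 * ln (h powr (1 / (h - 1))))"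

end

theory Submission
  imports Defs "HOL-Computational_Algebra.Fundamental_Theorem_Algebra"
begin

text \<open>
  Conjugating by \<open>A\<^sup>1\<^sup>/\<^sup>2\<close> reduces the claim to an inequality for functions of
  \<open>X = A\<^sup>-\<^sup>1\<^sup>/\<^sup>2 B A\<^sup>-\<^sup>1\<^sup>/\<^sup>2\<close>, whose spectrum lies in \<open>{1/h..h}\<close>. With \<open>u = sqrt t\<close> the scalar
  inequality for \<open>t \<in> {1/h..h}\<close> becomes the reverse Young inequality
  \<open>1 - \<mu> + \<mu> u \<le> S(sqrt h) u\<^sup>\<mu>\<close>, with \<open>\<mu> = 2\<nu>\<close> if \<open>\<nu> \<le> 1/2\<close>, and with \<open>\<mu> = 2\<nu> - 1\<close> after division
  by \<open>u\<close> otherwise. The functional calculus rests on the fact that \<open>p(A)\<close> is positive for every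
  real polynomial \<open>p\<close> that is nonnegative on the spectrum of \<open>A\<close>.
\<close>

section \<open>The underlying real inner product\<close>

text \<open>Stated for semidefinite forms because it serves both the inner product and the form of a
  positive operator, which may vanish on nonzero vectors. The form is expanded at
  \<open>f y y * x - f x y * y\<close>; if \<open>f x x\<close> and \<open>f y y\<close> are both 0,
  the expansions at \<open>x + y\<close> and \<open>x - y\<close> force
  \<open>f x y = 0\<close>.\<close>

lemma bilinear_Cauchy_Schwarz:
  fixes f :: "'a::real_vector \<Rightarrow> 'a \<Rightarrow> real"
  assumes bil: "bilinear f" and sym: "\<And>x y. f x y = f y x" and nonneg: "\<And>x. 0 \<le> f x x"
  shows "(f x y)\<^sup>2 \<le> f x x * f y y"
proof -
  have expand: "0 \<le> s\<^sup>2 * f x x + 2 * s * t * f x y + t\<^sup>2 * f y y" for s t x y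
  proof -
    have "f (s *\<^sub>R x + t *\<^sub>R y) (s *\<^sub>R x + t *\<^sub>R y) =
        s\<^sup>2 * f x x + 2 * s * t * f x y + t\<^sup>2 * f y y"
      using sym[of y x]
      by (simp add: bilinear_ladd[OF bil] bilinear_radd[OF bil] bilinear_lmul[OF bil]
          bilinear_rmul[OF bil] power2_eq_square algebra_simps)
    then show ?thesis using nonneg by metis
  qed
  have pos: "(f x y)\<^sup>2 \<le> f x x * f y y" if "0 < f y y" for x y
  proof -
    have "0 \<le> f y y * (f x x * f y y - (f x y)\<^sup>2)"
      using expand[of "f y y" x "- f x y" y] by (simp add: power2_eq_square algebra_simps)
    with that show ?thesis by (simp add: zero_le_mult_iff)
  qed
  consider "0 < f y y" | "0 < f x x" | "f x x = 0" "f y y = 0"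
    using nonneg[of x] nonneg[of y] by linarith
  then show ?thesis
  proof cases
    case 2
    then show ?thesis using pos[of x y] sym[of x y] by (simp add: mult.commute)
  next
    case 3
    have "f x y = 0" using expand[of 1 x 1 y] expand[of 1 x "-1" y] 3 by simp
    then show ?thesis using 3 by simp
  qed (rule pos)
qed

text \<open>The real part is a real inner product with the same norm, so real bilinear theory
  applies. For complex-linear operators nothing is lost: multiplication by \<open>\<i>\<close>
  recovers the imaginary part.\<close>

definition re_inner :: "'a::chilbert_space \<Rightarrow> 'a \<Rightarrow> real" where
  "re_inner x y = Re (cinner x y)"

lemma re_inner_commute: "re_inner x y = re_inner y x"
  unfolding re_inner_def by (subst cinner_commute) simp

lemma re_inner_self: "re_inner x x = (norm x)\<^sup>2"
  by (simp add: re_inner_def cinner_self)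

lemma re_inner_ii: "re_inner x (\<i> *\<^sub>C y) = - Im (cinner x y)"
  by (simp add: re_inner_def cinner_scaleC_right)

lemma bilinear_re_inner: "bilinear re_inner"
proof -
  have lin: "linear (re_inner x)" for x :: 'a
    by (rule linearI)
      (simp_all add: re_inner_def cinner_add_right cinner_scaleC_right flip: scaleC_of_real)
  moreover have "linear (\<lambda>x. re_inner x y)" for y :: 'a
    using lin[of y] by (simp add: re_inner_commute[of _ y])
  ultimately show ?thesis by (simp add: bilinear_def)
qed

lemma bounded_bilinear_re_inner: "bounded_bilinear re_inner"
proof
  show "\<exists>K. \<forall>x y :: 'a. norm (re_inner x y) \<le> norm x * norm y * K"
  proof (intro exI[of _ 1] allI)
    fix x y :: 'a
    have "(re_inner x y)\<^sup>2 \<le> (norm x * norm y)\<^sup>2"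
      using bilinear_Cauchy_Schwarz[OF bilinear_re_inner re_inner_commute, of x y]
      by (simp add: re_inner_self power_mult_distrib)
    then show "norm (re_inner x y) \<le> norm x * norm y * 1"
      by (simp add: abs_le_square_iff[symmetric])
  qed
qed (simp_all add: bilinear_ladd[OF bilinear_re_inner] bilinear_radd[OF bilinear_re_inner]
    bilinear_lmul[OF bilinear_re_inner] bilinear_rmul[OF bilinear_re_inner])

interpretation re_inner: bounded_bilinear re_inner
  by (rule bounded_bilinear_re_inner)

section \<open>Self-adjoint operators\<close>

lemmas blinfun_simps = blinfun.add_left blinfun.diff_left blinfun.scaleR_left
  blinfun.add_right blinfun.diff_right blinfun.scaleR_right blinfun.minus_left
  blinfun.minus_right blinfun.zero_left blinfun.zero_right

lemma scaleC_diff_right: "c *\<^sub>C (x - y) = c *\<^sub>C x - c *\<^sub>C y"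
  by (rule linear_diff) (rule bounded_linear.linear[OF bounded_linear_scaleC])

lemma scaleC_scaleR: "c *\<^sub>C (s *\<^sub>R x) = s *\<^sub>R (c *\<^sub>C x)"
  by (rule linear_scale) (rule bounded_linear.linear[OF bounded_linear_scaleC])

lemma complex_linear_op_closure:
  shows "complex_linear_op S \<Longrightarrow> complex_linear_op T \<Longrightarrow> complex_linear_op (S + T)"
    "complex_linear_op S \<Longrightarrow> complex_linear_op T \<Longrightarrow> complex_linear_op (S - T)"
    "complex_linear_op T \<Longrightarrow> complex_linear_op (s *\<^sub>R T)"
    "complex_linear_op S \<Longrightarrow> complex_linear_op T \<Longrightarrow> complex_linear_op (S o\<^sub>L T)"
  by (simp_all add: complex_linear_op_def blinfun_simps scaleC_add_right scaleC_diff_right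
      scaleC_scaleR)

lemma complex_linear_op_id: "complex_linear_op id_blinfun"
  by (simp add: complex_linear_op_def)

text \<open>Replacing \<open>y\<close> by \<open>\<i> *\<^sub>C y\<close> in the identity of real
  parts gives that of imaginary parts, as \<open>T\<close> commutes with
  \<open>\<i>\<close>.\<close>

lemma selfadjoint_op_iff:
  "selfadjoint_op T \<longleftrightarrow>
    complex_linear_op T \<and> (\<forall>x y. re_inner (blinfun_apply T x) y = re_inner x (blinfun_apply T y))"
proof (intro iffI conjI allI)
  assume T: "complex_linear_op T \<and>
    (\<forall>x y. re_inner (blinfun_apply T x) y = re_inner x (blinfun_apply T y))"
  then have lin: "blinfun_apply T (c *\<^sub>C x) = c *\<^sub>C blinfun_apply T x" for c x
    by (simp add: complex_linear_op_def)
  have "Im (cinner (blinfun_apply T x) y) = Im (cinner x (blinfun_apply T y))" for x y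
    using T lin re_inner_ii[of "blinfun_apply T x" y] re_inner_ii[of x "blinfun_apply T y"]
    by (metis add.inverse_inverse)
  with T show "selfadjoint_op T"
    by (simp add: selfadjoint_op_def complex_eq_iff re_inner_def)
qed (simp_all add: selfadjoint_op_def re_inner_def)

lemma selfadjoint_opD:
  assumes "selfadjoint_op T"
  shows "re_inner (blinfun_apply T x) y = re_inner x (blinfun_apply T y)"
  using assms by (simp add: selfadjoint_op_iff)

lemma selfadjoint_op_id: "selfadjoint_op id_blinfun"
  by (simp add: selfadjoint_op_def complex_linear_op_id)

lemma selfadjoint_op_closure:
  shows "selfadjoint_op S \<Longrightarrow> selfadjoint_op T \<Longrightarrow> selfadjoint_op (S + T)"
    "selfadjoint_op S \<Longrightarrow> selfadjoint_op T \<Longrightarrow> selfadjoint_op (S - T)"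
    "selfadjoint_op T \<Longrightarrow> selfadjoint_op (s *\<^sub>R T)"
    "selfadjoint_op S \<Longrightarrow> selfadjoint_op T \<Longrightarrow> selfadjoint_op (S o\<^sub>L T o\<^sub>L S)"
    "selfadjoint_op S \<Longrightarrow> selfadjoint_op T \<Longrightarrow> S o\<^sub>L T = T o\<^sub>L S \<Longrightarrow>
      selfadjoint_op (S o\<^sub>L T)"
proof -
  show "selfadjoint_op (S o\<^sub>L T)"
    if ST: "selfadjoint_op S" "selfadjoint_op T" "S o\<^sub>L T = T o\<^sub>L S"
  proof -
    have "blinfun_apply T (blinfun_apply S y) = blinfun_apply S (blinfun_apply T y)" for y
      using ST(3) by (metis blinfun_apply_blinfun_compose)
    with ST show ?thesis
      by (simp add: selfadjoint_op_iff complex_linear_op_closure)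
  qed
qed (simp_all add: selfadjoint_op_iff complex_linear_op_closure blinfun_simps
    re_inner.add_left re_inner.add_right re_inner.diff_left re_inner.diff_right
    re_inner.scaleR_left re_inner.scaleR_right)

lemma positive_op_iff:
  "positive_op T \<longleftrightarrow> selfadjoint_op T \<and> (\<forall>x. 0 \<le> re_inner x (blinfun_apply T x))"
proof -
  have "Im (cinner x (blinfun_apply T x)) = 0" if "selfadjoint_op T" for x
  proof -
    have "cinner x (blinfun_apply T x) = cnj (cinner x (blinfun_apply T x))"
      using that unfolding selfadjoint_op_def by (metis cinner_commute)
    then show ?thesis by (metis Reals_cnj_iff complex_is_Real_iff)
  qed
  then show ?thesis
    by (auto simp: positive_op_def re_inner_def complex_nonneg_Reals_iff)
qed

lemma op_ge_iff:
  "S \<succeq> T \<longleftrightarrow> selfadjoint_op S \<and> selfadjoint_op T \<and>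
    (\<forall>x. re_inner x (blinfun_apply T x) \<le> re_inner x (blinfun_apply S x))"
  by (auto simp: op_ge_def positive_op_iff selfadjoint_op_closure blinfun_simps
      re_inner.diff_right)

lemma selfadjoint_op_limit:
  assumes lim: "T \<longlonglongrightarrow> L" and T: "\<And>n. selfadjoint_op (T n)"
  shows "selfadjoint_op L"
proof -
  have app: "(\<lambda>n. blinfun_apply (T n) x) \<longlonglongrightarrow> blinfun_apply L x" for x
    using lim by (intro tendsto_intros)
  have "blinfun_apply L (c *\<^sub>C x) = c *\<^sub>C blinfun_apply L x" for c x
  proof (rule LIMSEQ_unique[OF app])
    have "(\<lambda>n. c *\<^sub>C blinfun_apply (T n) x) \<longlonglongrightarrow> c *\<^sub>C blinfun_apply L x"
      by (rule bounded_linear.tendsto[OF bounded_linear_scaleC app])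
    then show "(\<lambda>n. blinfun_apply (T n) (c *\<^sub>C x)) \<longlonglongrightarrow> c *\<^sub>C blinfun_apply L x"
      using T by (simp add: selfadjoint_op_def complex_linear_op_def)
  qed
  moreover have "re_inner (blinfun_apply L x) y = re_inner x (blinfun_apply L y)" for x y
  proof (rule LIMSEQ_unique)
    show "(\<lambda>n. re_inner (blinfun_apply (T n) x) y) \<longlonglongrightarrow> re_inner (blinfun_apply L x) y"
      by (intro re_inner.tendsto app tendsto_const)
    show "(\<lambda>n. re_inner (blinfun_apply (T n) x) y) \<longlonglongrightarrow> re_inner x (blinfun_apply L y)"
      unfolding selfadjoint_opD[OF T] by (intro re_inner.tendsto app tendsto_const)
  qed
  ultimately show ?thesis by (simp add: selfadjoint_op_iff complex_linear_op_def)
qed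

text \<open>This says that T^2 is at most c T. Cauchy-Schwarz for the form
  \<open>re_inner y (T z)\<close> at \<open>y = T x\<close> and \<open>z = x\<close> gives it after
  division by the squared norm of \<open>T x\<close>.\<close>

lemma positive_op_norm_le:
  assumes T: "positive_op T" and c: "\<And>x. re_inner x (blinfun_apply T x) \<le> c * (norm x)\<^sup>2"
  shows "(norm (blinfun_apply T x))\<^sup>2 \<le> c * re_inner x (blinfun_apply T x)"
proof (cases "blinfun_apply T x = 0")
  case True
  then show ?thesis by (simp add: re_inner.zero_right)
next
  case False
  define f where "f y z = re_inner y (blinfun_apply T z)" for y z
  have nonneg: "0 \<le> f y y" for y using T by (simp add: f_def positive_op_iff)
  have "bilinear f"
    unfolding bilinear_def f_def
    by (auto intro!: linearI simp: blinfun_simps re_inner.add_left re_inner.add_right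
        re_inner.scaleR_left re_inner.scaleR_right)
  moreover have "f y z = f z y" for y z
    using T by (metis f_def positive_op_iff selfadjoint_opD re_inner_commute)
  ultimately have "(f (blinfun_apply T x) x)\<^sup>2 \<le> f (blinfun_apply T x) (blinfun_apply T x) * f x x"
    using nonneg by (rule bilinear_Cauchy_Schwarz)
  also have "\<dots> \<le> c * (norm (blinfun_apply T x))\<^sup>2 * f x x"
    using c[of "blinfun_apply T x"] nonneg[of x] by (intro mult_right_mono) (auto simp: f_def)
  finally have "(norm (blinfun_apply T x))\<^sup>2 * (norm (blinfun_apply T x))\<^sup>2 \<le>
      (norm (blinfun_apply T x))\<^sup>2 * (c * f x x)"
    by (simp add: f_def re_inner_self power2_eq_square mult_ac)
  then have "(norm (blinfun_apply T x))\<^sup>2 \<le> c * f x x"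
    using False by (simp only: mult_le_cancel_left) simp
  then show ?thesis by (simp add: f_def)
qed

lemma re_inner_le_norm: "re_inner x (blinfun_apply T x) \<le> norm T * (norm x)\<^sup>2"
proof -
  have "(re_inner x (blinfun_apply T x))\<^sup>2 \<le> (norm x * norm (blinfun_apply T x))\<^sup>2"
    using bilinear_Cauchy_Schwarz[OF bilinear_re_inner re_inner_commute, of x "blinfun_apply T x"]
    by (simp add: re_inner_self power_mult_distrib)
  then have "re_inner x (blinfun_apply T x) \<le> norm x * norm (blinfun_apply T x)"
    by (rule power2_le_imp_le) simp
  also have "\<dots> \<le> norm x * (norm T * norm x)"
    by (intro mult_left_mono norm_blinfun) simp
  finally show ?thesis by (simp add: power2_eq_square mult_ac)
qed

section \<open>Invertibility\<close>

lemma invertible_op_compose: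
  assumes "invertible_op S" "invertible_op T"
  shows "invertible_op (S o\<^sub>L T)"
proof -
  obtain S' T' where *: "complex_linear_op S'" "S o\<^sub>L S' = id_blinfun" "S' o\<^sub>L S = id_blinfun"
    "complex_linear_op T'" "T o\<^sub>L T' = id_blinfun" "T' o\<^sub>L T = id_blinfun"
    using assms unfolding invertible_op_def by blast
  have inv: "blinfun_apply S (blinfun_apply S' x) = x" "blinfun_apply S' (blinfun_apply S x) = x"
    "blinfun_apply T (blinfun_apply T' x) = x" "blinfun_apply T' (blinfun_apply T x) = x" for x
    using * by (metis blinfun_apply_blinfun_compose blinfun_apply_id_blinfun)+
  have "(S o\<^sub>L T) o\<^sub>L (T' o\<^sub>L S') = id_blinfun" "(T' o\<^sub>L S') o\<^sub>L (S o\<^sub>L T) = id_blinfun"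
    by (simp_all add: blinfun_eqI inv)
  then show ?thesis
    using assms * complex_linear_op_closure(4) unfolding invertible_op_def by metis
qed

lemma invertible_op_uminus:
  assumes "invertible_op T"
  shows "invertible_op (- T)"
proof -
  obtain T' where *: "complex_linear_op T'" "T o\<^sub>L T' = id_blinfun" "T' o\<^sub>L T = id_blinfun"
    using assms unfolding invertible_op_def by blast
  have "complex_linear_op (- T)" "complex_linear_op (- T')"
    using assms * complex_linear_op_closure(3)[of T "-1"] complex_linear_op_closure(3)[of T' "-1"]
    by (auto simp: invertible_op_def)
  moreover have "(- T) o\<^sub>L (- T') = id_blinfun" "(- T') o\<^sub>L (- T) = id_blinfun"
    using * by (simp_all add: bounded_bilinear.minus_left[OF bounded_bilinear_blinfun_compose]
        bounded_bilinear.minus_right[OF bounded_bilinear_blinfun_compose])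
  ultimately show ?thesis unfolding invertible_op_def by blast
qed

text \<open>Once \<open>K\<close> exceeds the norm, \<open>x \<mapsto> x - T x / K + y / K\<close> is a contraction with fixed point
  \<open>T\<inverse> y\<close>.\<close>

lemma invertible_op_coercive:
  assumes T: "selfadjoint_op T" and "0 < d"
    and coercive: "\<And>x. d * (norm x)\<^sup>2 \<le> re_inner x (blinfun_apply T x)"
  shows "invertible_op T"
proof -
  \<comment> \<open>Adding \<open>d\<close> keeps \<open>K\<close> positive even if
    \<open>norm T = 0\<close>, and gives \<open>d \<le> K\<close>. Then \<open>T \<le> K\<close>
    makes \<open>S\<close> positive, and \<open>T \<ge> d\<close> bounds its form by
    \<open>c < 1\<close>.\<close>
  define K where "K = norm T + d"
  define S where "S = id_blinfun - (1 / K) *\<^sub>R T"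
  define c where "c = 1 - d / K"
  have K: "0 < K" "d \<le> K" using \<open>0 < d\<close> by (auto simp: K_def add_nonneg_pos)
  then have c: "0 \<le> c" "c < 1" using \<open>0 < d\<close> by (auto simp: c_def)
  have S_form: "re_inner x (blinfun_apply S x) = (norm x)\<^sup>2 - re_inner x (blinfun_apply T x) / K" for x
    by (simp add: S_def blinfun_simps re_inner.diff_right re_inner.scaleR_right re_inner_self)
  have S_le: "re_inner x (blinfun_apply S x) \<le> c * (norm x)\<^sup>2" for x
    using coercive[of x] K by (simp add: S_form c_def field_simps)
  have "re_inner x (blinfun_apply T x) / K \<le> (norm x)\<^sup>2" for x
  proof -
    have "norm T * (norm x)\<^sup>2 \<le> K * (norm x)\<^sup>2"
      using \<open>0 < d\<close> by (intro mult_right_mono) (auto simp: K_def)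
    then have "re_inner x (blinfun_apply T x) \<le> K * (norm x)\<^sup>2"
      using re_inner_le_norm[of x T] by (rule order_trans[rotated])
    then show ?thesis using K by (simp add: field_simps)
  qed
  moreover have "selfadjoint_op S"
    unfolding S_def by (intro selfadjoint_op_closure selfadjoint_op_id T)
  ultimately have "positive_op S" by (simp add: positive_op_iff S_form)
  then have S_norm: "norm (blinfun_apply S x) \<le> c * norm x" for x
  proof -
    \<comment> \<open>One factor \<open>c\<close> comes from \<open>positive_op_norm_le\<close>, the
      other from the bound on the form of \<open>S\<close>.\<close>
    have "(norm (blinfun_apply S x))\<^sup>2 \<le> c * (c * (norm x)\<^sup>2)"
      using positive_op_norm_le[OF \<open>positive_op S\<close> S_le, of x] S_le[of x] c(1)
      by (meson mult_left_mono order_trans)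
    then have "(norm (blinfun_apply S x))\<^sup>2 \<le> (c * norm x)\<^sup>2"
      by (simp add: power2_eq_square mult_ac)
    then show ?thesis by (rule power2_le_imp_le) (use c(1) in simp)
  qed
  have surj: "\<exists>x. blinfun_apply T x = y" for y
  proof -
    have "\<exists>!x. blinfun_apply S x + (1 / K) *\<^sub>R y = x"
    proof (intro banach_fix_type[OF c] allI)
      show "dist (blinfun_apply S x + (1 / K) *\<^sub>R y) (blinfun_apply S x' + (1 / K) *\<^sub>R y) \<le>
          c * dist x x'" for x x'
        using S_norm[of "x - x'"] by (simp add: dist_norm blinfun.diff_right)
    qed
    then obtain x where "blinfun_apply S x + (1 / K) *\<^sub>R y = x" by auto
    then have "(1 / K) *\<^sub>R y = (1 / K) *\<^sub>R blinfun_apply T x"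
      by (simp add: S_def blinfun_simps algebra_simps)
    then show ?thesis using K by auto
  qed
  \<comment> \<open>As \<open>x - S x = T x / K\<close>, the contraction bound yields injectivity of
    \<open>T\<close> and the bound \<open>1 / d\<close> for the inverse.\<close>
  have lower: "d * norm x \<le> norm (blinfun_apply T x)" for x
  proof (cases "x = 0")
    case False
    have "(1 - c) * norm x \<le> norm x - norm (blinfun_apply S x)"
      using S_norm[of x] by (simp add: algebra_simps)
    also have "\<dots> \<le> norm (x - blinfun_apply S x)" by (rule norm_triangle_ineq2)
    also have "\<dots> = norm (blinfun_apply T x) / K"
      using K by (simp add: S_def blinfun_simps)
    finally show ?thesis using K by (simp add: c_def field_simps)
  qed simp
  have inj: "x = y" if "blinfun_apply T x = blinfun_apply T y" for x y
  proof -
    have "d * norm (x - y) \<le> 0" using lower[of "x - y"] that by (simp add: blinfun_simps)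
    with \<open>0 < d\<close> show ?thesis by (simp add: mult_le_0_iff)
  qed
  define g where "g = inv (blinfun_apply T)"
  have Tg: "blinfun_apply T (g y) = y" for y
  proof -
    obtain x where "y = blinfun_apply T x" using surj by metis
    then show ?thesis by (simp add: g_def f_inv_into_f)
  qed
  have gT: "g (blinfun_apply T x) = x" for x by (rule inj) (rule Tg)
  have Tlin: "blinfun_apply T (c *\<^sub>C x) = c *\<^sub>C blinfun_apply T x" for c x
    using T by (simp add: selfadjoint_op_def complex_linear_op_def)
  have "bounded_linear g"
  proof (rule bounded_linear_intro)
    show "g (x + y) = g x + g y" for x y by (rule inj) (simp add: Tg blinfun_simps)
    show "g (r *\<^sub>R x) = r *\<^sub>R g x" for r x by (rule inj) (simp add: Tg blinfun_simps)
    show "norm (g x) \<le> norm x * (1 / d)" for x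
      using lower[of "g x"] \<open>0 < d\<close> by (simp add: Tg field_simps)
  qed
  then have G: "blinfun_apply (Blinfun g) = g" by (rule bounded_linear_Blinfun_apply)
  have "complex_linear_op (Blinfun g)"
    unfolding complex_linear_op_def G by (intro allI, rule inj) (simp add: Tg Tlin)
  moreover have "T o\<^sub>L Blinfun g = id_blinfun" "Blinfun g o\<^sub>L T = id_blinfun"
    by (auto intro!: blinfun_eqI simp: G Tg gT)
  ultimately show ?thesis
    using T unfolding invertible_op_def selfadjoint_op_def by blast
qed

text \<open>A bounded inverse bounds \<open>norm x\<close> by a multiple of
  \<open>norm (T x)\<close>, whose square \<open>positive_op_norm_le\<close> bounds by a multiple of
  the form.\<close>

lemma positive_invertible_coercive:
  assumes T: "positive_op T" and "invertible_op T"
  obtains d where "0 < d" "\<And>x. d * (norm x)\<^sup>2 \<le> re_inner x (blinfun_apply T x)"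
proof -
  obtain T' where "T' o\<^sub>L T = id_blinfun"
    using assms unfolding invertible_op_def by blast
  then have inv: "blinfun_apply T' (blinfun_apply T x) = x" for x
    by (metis blinfun_apply_blinfun_compose blinfun_apply_id_blinfun)
  \<comment> \<open>The added ones keep \<open>K\<close> positive on the trivial space, where both
    norms are 0.\<close>
  define K where "K = (norm T + 1) * (norm T' + 1)\<^sup>2"
  have pos: "0 < norm S + 1" for S :: "'a \<Rightarrow>\<^sub>L 'a" by (simp add: add_nonneg_pos)
  have K: "0 < K" unfolding K_def by (rule mult_pos_pos[OF pos zero_less_power[OF pos]])
  have "1 / K * (norm x)\<^sup>2 \<le> re_inner x (blinfun_apply T x)" for x
  proof -
    have "norm x \<le> norm T' * norm (blinfun_apply T x)"
      using norm_blinfun[of T' "blinfun_apply T x"] by (simp add: inv)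
    also have "\<dots> \<le> (norm T' + 1) * norm (blinfun_apply T x)"
      by (intro mult_right_mono) auto
    finally have "(norm x)\<^sup>2 \<le> (norm T' + 1)\<^sup>2 * (norm (blinfun_apply T x))\<^sup>2"
      by (simp add: power_mono flip: power_mult_distrib)
    also have "\<dots> \<le> (norm T' + 1)\<^sup>2 * ((norm T + 1) * re_inner x (blinfun_apply T x))"
    proof (intro mult_left_mono positive_op_norm_le[OF T])
      show "re_inner x (blinfun_apply T x) \<le> (norm T + 1) * (norm x)\<^sup>2" for x
        using re_inner_le_norm[of x T] by (simp add: distrib_right add_increasing2)
    qed simp
    finally show ?thesis using K by (simp add: K_def field_simps)
  qed
  with K that[of "1 / K"] show ?thesis by simp
qed

section \<open>Polynomials of an operator\<close>

lemma compose_assoc: "(A o\<^sub>L B) o\<^sub>L C = A o\<^sub>L (B o\<^sub>L C)"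
  by (rule blinfun_eqI) simp

lemma compose_id: "A o\<^sub>L id_blinfun = A" "id_blinfun o\<^sub>L A = A"
  by (auto intro: blinfun_eqI)

lemmas compose_distribs =
  bounded_bilinear.add_left[OF bounded_bilinear_blinfun_compose]
  bounded_bilinear.add_right[OF bounded_bilinear_blinfun_compose]
  bounded_bilinear.diff_left[OF bounded_bilinear_blinfun_compose]
  bounded_bilinear.diff_right[OF bounded_bilinear_blinfun_compose]
  bounded_bilinear.scaleR_left[OF bounded_bilinear_blinfun_compose]
  bounded_bilinear.scaleR_right[OF bounded_bilinear_blinfun_compose]

lemma op_poly_0 [simp]: "op_poly 0 A = 0"
  by (simp add: op_poly_def)

text \<open>Horner's rule, on which the inductions over polynomials below rest. The case
  \<open>p = 0\<close> is separate because there the degree of \<open>pCons a p\<close> is 0 and not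
  \<open>Suc (degree p)\<close>.\<close>

lemma op_poly_pCons [simp]: "op_poly (pCons a p) A = a *\<^sub>R id_blinfun + (A o\<^sub>L op_poly p A)"
proof (cases "p = 0")
  case True
  then show ?thesis by (auto simp: op_poly_def intro!: blinfun_eqI)
next
  case False
  then have "op_poly (pCons a p) A = a *\<^sub>R id_blinfun +
      (\<Sum>i\<le>degree p. coeff p i *\<^sub>R (A o\<^sub>L ((o\<^sub>L) A ^^ i) id_blinfun))"
    by (simp add: op_poly_def sum.atMost_Suc_shift del: sum.atMost_Suc)
  also have "(\<Sum>i\<le>degree p. coeff p i *\<^sub>R (A o\<^sub>L ((o\<^sub>L) A ^^ i) id_blinfun)) = A o\<^sub>L op_poly p A"
    by (simp add: op_poly_def compose_distribs
        bounded_bilinear.sum_right[OF bounded_bilinear_blinfun_compose])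
  finally show ?thesis .
qed

lemma op_poly_add: "op_poly (p + q) A = op_poly p A + op_poly q A"
  by (induction p q rule: poly_induct2) (simp_all add: compose_distribs algebra_simps)

lemma op_poly_smult: "op_poly (smult c p) A = c *\<^sub>R op_poly p A"
  by (induction p) (simp_all add: compose_distribs scaleR_add_right)

lemma op_poly_diff: "op_poly (p - q) A = op_poly p A - op_poly q A"
  using op_poly_add[of p "smult (-1) q" A] op_poly_smult[of "-1" q A] by simp

lemma op_poly_mult: "op_poly (p * q) A = op_poly p A o\<^sub>L op_poly q A"
  by (induction p)
    (simp_all add: op_poly_add op_poly_smult compose_distribs compose_id compose_assoc)

lemma op_poly_commute: "A o\<^sub>L op_poly p A = op_poly p A o\<^sub>L A"
  using op_poly_mult[of "[:0, 1:]" p A] op_poly_mult[of p "[:0, 1:]" A]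
  by (simp add: compose_id mult.commute)

lemma selfadjoint_op_poly: "selfadjoint_op A \<Longrightarrow> selfadjoint_op (op_poly p A)"
  by (induction p)
    (use selfadjoint_op_closure(3)[OF selfadjoint_op_id, of 0] in
      \<open>auto intro!: selfadjoint_op_closure selfadjoint_op_id op_poly_commute\<close>)

text \<open>The set on which the definition of \<open>cfc\<close> requires uniform
  convergence.\<close>

definition real_spectrum :: "('a::chilbert_space \<Rightarrow>\<^sub>L 'a) \<Rightarrow> real set" where
  "real_spectrum A = {t. complex_of_real t \<in> op_spectrum A}"

lemma real_spectrum_iff: "t \<in> real_spectrum A \<longleftrightarrow> \<not> invertible_op (A - t *\<^sub>R id_blinfun)"
proof -
  have "scalar_op (complex_of_real t) = t *\<^sub>R (id_blinfun :: 'a \<Rightarrow>\<^sub>L 'a)"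
    by (rule blinfun_eqI) (simp add: scalar_op_apply scaleC_of_real blinfun_simps)
  then show ?thesis by (simp add: real_spectrum_def op_spectrum_def)
qed

text \<open>A complex root \<open>z = a + \<i> b\<close> of \<open>q\<close> exists. If it is real,
  it gives a linear factor; otherwise its minimal polynomial over the reals, with roots
  \<open>z\<close> and \<open>cnj z\<close>, divides \<open>q\<close>.\<close>

lemma real_poly_factor:
  fixes q :: "real poly"
  assumes "degree q > 0"
  obtains a where "[:- a, 1:] dvd q" | a b where "b \<noteq> 0" "[:a\<^sup>2 + b\<^sup>2, - 2 * a, 1:] dvd q"
proof -
  define ev where "ev p z = poly (map_poly complex_of_real p) z" for p z
  have ev_pCons: "ev (pCons c p) z = of_real c + z * ev p z" for c p z
    by (simp add: ev_def map_poly_pCons)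
  have ev_0: "ev 0 z = 0" for z by (simp add: ev_def)
  have ev_add: "ev (p + p') z = ev p z + ev p' z" for p p' z
    by (induction p p' rule: poly_induct2) (simp_all add: ev_pCons ev_0 algebra_simps)
  have ev_smult: "ev (smult c p) z = of_real c * ev p z" for c p z
    by (induction p) (simp_all add: ev_pCons ev_0 algebra_simps)
  have ev_mult: "ev (p * p') z = ev p z * ev p' z" for p p' z
    by (induction p) (simp_all add: ev_pCons ev_0 ev_add ev_smult algebra_simps)
  have ev_real: "ev p (of_real t) = of_real (poly p t)" for p t
    by (induction p) (simp_all add: ev_pCons ev_0)
  have "degree (map_poly complex_of_real q) = degree q"
    by (rule degree_map_poly) (use assms in auto)
  then obtain z where z: "ev q z = 0"
    using assms fundamental_theorem_of_algebra[of "map_poly complex_of_real q"]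
    by (auto simp: ev_def constant_degree)
  show thesis
  proof (cases "Im z = 0")
    case True
    then have "z = of_real (Re z)" by (simp add: complex_eq_iff)
    then have "poly q (Re z) = 0" using z ev_real[of q "Re z"] by simp
    then show thesis using that(1) by (simp add: poly_eq_0_iff_dvd)
  next
    case False
    define D where "D = [:(Re z)\<^sup>2 + (Im z)\<^sup>2, - 2 * Re z, 1:]"
    have evD: "ev D z = 0"
      by (simp add: D_def ev_pCons ev_0 complex_eq_iff power2_eq_square algebra_simps)
    \<comment> \<open>The remainder \<open>r0 + r1 z\<close> vanishes at the nonreal
      \<open>z\<close>, so its imaginary part forces \<open>r1 = 0\<close>, and then
      \<open>r0 = 0\<close>.\<close>
    have "ev q z = ev (q div D) z * ev D z + ev (q mod D) z"
      by (metis div_mult_mod_eq ev_add ev_mult)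
    then have mod0: "ev (q mod D) z = 0" using z evD by simp
    have "degree (q mod D) < 2"
      using degree_mod_less[of D q] by (auto simp: D_def)
    then have "q mod D = [:coeff (q mod D) 0, coeff (q mod D) 1:]"
      by (intro poly_eqI) (auto simp: coeff_pCons coeff_eq_0 split: nat.splits)
    then obtain r0 r1 where r: "q mod D = [:r0, r1:]" by blast
    then have "r1 * Im z = 0" "r0 + r1 * Re z = 0"
      using mod0 by (simp_all add: ev_pCons ev_0 complex_eq_iff mult.commute)
    with False r have "D dvd q" by (simp add: dvd_eq_mod_eq_0)
    with False show thesis using that(2) by (simp add: D_def)
  qed
qed

text \<open>Each real factor of \<open>q\<close> gives an invertible operator: a linear one because
  its root lies off the spectrum, a quadratic one because \<open>(A - a)^2 + b^2\<close> is coercive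
  with constant \<open>b^2\<close>. Real factors thus suffice, without knowing that the spectrum is
  real.\<close>

lemma invertible_op_poly:
  assumes A: "selfadjoint_op A" and "q \<noteq> 0"
    and "\<And>t. t \<in> real_spectrum A \<Longrightarrow> poly q t \<noteq> 0"
  shows "invertible_op (op_poly q A)"
  using assms(2-)
proof (induction "degree q" arbitrary: q rule: less_induct)
  case less
  have factor: "invertible_op (op_poly q A)"
    if "q = D * q'" "degree D > 0" "invertible_op (op_poly D A)" for D q'
  proof -
    have "q' \<noteq> 0" "D \<noteq> 0" using that(1) less.prems(1) by auto
    then have "degree q' < degree q" using that by (simp add: degree_mult_eq)
    then have "invertible_op (op_poly q' A)"
      using less that \<open>q' \<noteq> 0\<close> by auto
    then show ?thesis using that by (simp add: op_poly_mult invertible_op_compose)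
  qed
  show ?case
  proof (cases "degree q = 0")
    case True
    then obtain c where "q = [:c:]" by (rule degree_eq_zeroE)
    with less.prems have "c \<noteq> 0" by simp
    let ?C = "\<lambda>c. c *\<^sub>R (id_blinfun :: 'a \<Rightarrow>\<^sub>L 'a)"
    have "?C c o\<^sub>L ?C (1 / c) = id_blinfun" "?C (1 / c) o\<^sub>L ?C c = id_blinfun"
      using \<open>c \<noteq> 0\<close> by (simp_all add: compose_distribs compose_id)
    moreover have "complex_linear_op (?C s)" for s
      using complex_linear_op_closure(3) complex_linear_op_id by blast
    ultimately show ?thesis using \<open>q = [:c:]\<close> unfolding invertible_op_def by auto
  next
    case False
    then have "degree q > 0" by simp
    then show ?thesis
    proof (cases rule: real_poly_factor)
      case (1 a)
      then obtain q' where q: "q = [:- a, 1:] * q'" by (elim dvdE)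
      then have "poly q a = 0" by simp
      then have "a \<notin> real_spectrum A" using less.prems by blast
      then have "invertible_op (op_poly [:- a, 1:] A)"
        by (simp add: real_spectrum_iff compose_id)
      then show ?thesis using factor[OF q] by simp
    next
      case (2 a b)
      then obtain q' where q: "q = [:a\<^sup>2 + b\<^sup>2, - 2 * a, 1:] * q'" by (elim dvdE)
      let ?T = "op_poly [:a\<^sup>2 + b\<^sup>2, - 2 * a, 1:] A"
      define S where "S = A - a *\<^sub>R id_blinfun"
      have S: "selfadjoint_op S"
        unfolding S_def by (intro selfadjoint_op_closure A selfadjoint_op_id)
      have T: "?T = (S o\<^sub>L S) + b\<^sup>2 *\<^sub>R id_blinfun"
        by (rule blinfun_eqI)
          (simp add: S_def blinfun_simps power2_eq_square algebra_simps flip: scaleR_2)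
      have "invertible_op ?T"
      proof (rule invertible_op_coercive)
        show "selfadjoint_op ?T" using A by (rule selfadjoint_op_poly)
        show "0 < b\<^sup>2" using 2 by simp
        fix x
        have "re_inner x (blinfun_apply (S o\<^sub>L S) x) = (norm (blinfun_apply S x))\<^sup>2"
          by (simp add: re_inner_self selfadjoint_opD[OF S, symmetric])
        then have "re_inner x (blinfun_apply ?T x) = (norm (blinfun_apply S x))\<^sup>2 + b\<^sup>2 * (norm x)\<^sup>2"
          unfolding T by (simp add: blinfun.add_left blinfun.scaleR_left re_inner.add_right
              re_inner.scaleR_right re_inner_self)
        then show "b\<^sup>2 * (norm x)\<^sup>2 \<le> re_inner x (blinfun_apply ?T x)" by simp
      qed
      then show ?thesis using factor[OF q] by simp
    qed
  qed
qed

text \<open>If the infimum \<open>c\<close> of the numerical range of \<open>p(A)\<close> were negative, then \<open>p - c\<close> would have no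
  root on the spectrum, so the positive operator \<open>p(A) - c\<close> would be invertible, hence bounded
  below, contradicting the choice of \<open>c\<close>.\<close>

lemma positive_op_poly_nonconst:
  assumes A: "selfadjoint_op A" and deg: "degree p > 0" and p: "\<And>t. t \<in> real_spectrum A \<Longrightarrow> 0 \<le> poly p t"
  shows "positive_op (op_poly p A)"
proof -
  let ?T = "op_poly p A"
  define W where "W = (\<lambda>x. re_inner x (blinfun_apply ?T x)) ` {x. norm x = 1}"
  have T: "selfadjoint_op ?T" using A by (rule selfadjoint_op_poly)
  have bdd: "bdd_below W"
  proof (rule bdd_belowI)
    fix w assume w: "w \<in> W"
    obtain x where "norm x = 1" "w = re_inner x (blinfun_apply ?T x)"
      using w by (auto simp: W_def)
    then show "- norm ?T \<le> w"
      using re_inner_le_norm[of x "- ?T"] by (simp add: blinfun_simps re_inner.minus_right)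
  qed
  have scaled: "c * (norm x)\<^sup>2 \<le> re_inner x (blinfun_apply ?T x)"
    if "\<And>w. w \<in> W \<Longrightarrow> c \<le> w" for c x
  proof (cases "x = 0")
    case False
    define y where "y = (1 / norm x) *\<^sub>R x"
    have "c \<le> re_inner y (blinfun_apply ?T y)"
      using False by (intro that) (auto simp: W_def y_def)
    also have "\<dots> = re_inner x (blinfun_apply ?T x) / (norm x)\<^sup>2"
      by (simp add: y_def blinfun_simps re_inner.scaleR_left re_inner.scaleR_right power2_eq_square)
    finally show ?thesis using False by (simp add: field_simps)
  qed (simp add: re_inner.zero_left)
  have "\<forall>w\<in>W. 0 \<le> w"
  proof (rule ccontr)
    assume "\<not> ?thesis"
    then obtain w where w: "w \<in> W" "w < 0" by force
    define c where "c = Inf W"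
    have c_le: "c \<le> w" if "w \<in> W" for w
      unfolding c_def using bdd that by (rule cInf_lower[rotated])
    have "c < 0" using c_le w by force
    define q where "q = p - [:c:]"
    have qA: "op_poly q A = ?T - c *\<^sub>R id_blinfun"
      by (simp add: q_def op_poly_diff)
    have q_form: "re_inner x (blinfun_apply (op_poly q A) x) =
        re_inner x (blinfun_apply ?T x) - c * (norm x)\<^sup>2" for x
      by (simp add: qA blinfun_simps re_inner.diff_right re_inner.scaleR_right re_inner_self)
    have qpos: "positive_op (op_poly q A)"
      using selfadjoint_op_poly[OF A] scaled[OF c_le] by (simp add: positive_op_iff q_form)
    have "poly q t \<noteq> 0" if "t \<in> real_spectrum A" for t
      using p[OF that] \<open>c < 0\<close> by (simp add: q_def)
    \<comment> \<open>This is where the positive degree enters: a constant \<open>p\<close> could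
      equal \<open>c\<close>.\<close>
    moreover have "q \<noteq> 0"
      using deg by (auto simp: q_def)
    ultimately have "invertible_op (op_poly q A)"
      by (intro invertible_op_poly[OF A])
    then obtain d where d: "0 < d"
      "\<And>x. d * (norm x)\<^sup>2 \<le> re_inner x (blinfun_apply (op_poly q A) x)"
      using positive_invertible_coercive[OF qpos] by blast
    have "c + d \<le> w" if w: "w \<in> W" for w
    proof -
      obtain x where "norm x = 1" "w = re_inner x (blinfun_apply ?T x)"
        using w by (auto simp: W_def)
      then show ?thesis using d(2)[of x] by (simp add: q_form)
    qed
    then have "c + d \<le> c" unfolding c_def using w by (intro cInf_greatest) auto
    with d show False by simp
  qed
  then have "0 * (norm x)\<^sup>2 \<le> re_inner x (blinfun_apply ?T x)" for x
    by (intro scaled) auto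
  with T show ?thesis by (simp add: positive_op_iff)
qed

text \<open>Only constants remain. A point of the spectrum shows that the constant is nonnegative,
  so it must be ruled out that the spectrum is empty on a nontrivial space.\<close>

lemma positive_op_poly:
  assumes A: "selfadjoint_op A" and p: "\<And>t. t \<in> real_spectrum A \<Longrightarrow> 0 \<le> poly p t"
  shows "positive_op (op_poly p A)"
proof (cases "degree p = 0")
  case True
  then obtain c where c: "p = [:c:]" by (rule degree_eq_zeroE)
  have "0 \<le> c * (norm x)\<^sup>2" for x :: 'a
  proof (cases "real_spectrum A = {} \<and> x \<noteq> 0")
    case True
    \<comment> \<open>On an empty spectrum \<open>[:- s, 1:]\<close> is vacuously nonnegative, so
      \<open>A - s\<close> would be positive; but \<open>s\<close> exceeds the Rayleigh quotient at
      \<open>x\<close>.\<close>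
    define s where "s = re_inner x (blinfun_apply A x) / (norm x)\<^sup>2 + 1"
    have "positive_op (op_poly [:- s, 1:] A)"
      using True by (intro positive_op_poly_nonconst[OF A]) auto
    then have "s * (norm x)\<^sup>2 \<le> re_inner x (blinfun_apply A x)"
      by (simp add: positive_op_iff compose_id blinfun_simps re_inner.diff_right
          re_inner.scaleR_right re_inner_self)
    then show ?thesis using True by (simp add: s_def field_simps)
  next
    case False
    then show ?thesis using p c by auto
  qed
  then show ?thesis
    using selfadjoint_op_poly[OF A, of p]
    by (simp add: positive_op_iff c blinfun_simps re_inner.scaleR_right re_inner_self)
qed (use positive_op_poly_nonconst[OF A] p in simp)

section \<open>The continuous functional calculus\<close>

text \<open>The polynomial \<open>e^2 - p^2\<close> is nonnegative on the spectrum, so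
  \<open>e^2 - p(A)^2\<close> is positive.\<close>

lemma op_poly_norm_le:
  assumes A: "selfadjoint_op A" and "0 \<le> e"
    and e: "\<And>t. t \<in> real_spectrum A \<Longrightarrow> \<bar>poly p t\<bar> \<le> e"
  shows "norm (op_poly p A) \<le> e"
proof (rule norm_blinfun_bound[OF \<open>0 \<le> e\<close>])
  fix x
  have "positive_op (op_poly ([:e\<^sup>2:] - p * p) A)"
  proof (rule positive_op_poly[OF A])
    fix t assume "t \<in> real_spectrum A"
    then show "0 \<le> poly ([:e\<^sup>2:] - p * p) t"
      using abs_le_square_iff[of "poly p t" e] e \<open>0 \<le> e\<close> by (simp add: power2_eq_square)
  qed
  then have "0 \<le> e\<^sup>2 * (norm x)\<^sup>2 - (norm (blinfun_apply (op_poly p A) x))\<^sup>2"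
    using selfadjoint_opD[OF selfadjoint_op_poly[OF A], symmetric]
    by (simp add: positive_op_iff op_poly_diff op_poly_mult blinfun_simps re_inner.diff_right
        re_inner.scaleR_right re_inner_self)
  then have "(norm (blinfun_apply (op_poly p A) x))\<^sup>2 \<le> (e * norm x)\<^sup>2"
    by (simp add: power_mult_distrib)
  then show "norm (blinfun_apply (op_poly p A) x) \<le> e * norm x"
    by (rule power2_le_imp_le) (use \<open>0 \<le> e\<close> in simp)
qed

text \<open>Polynomials that are uniformly close on the spectrum give operators close in norm.
  Applied to one sequence this yields convergence, applied to two it shows that the limit is the
  same, so the \<open>THE\<close> in \<open>cfc\<close> is well defined.\<close>

lemma cfc_limit:
  assumes A: "selfadjoint_op A"
    and p: "uniform_limit (real_spectrum A) (\<lambda>n. poly (p n)) f sequentially"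
  shows "(\<lambda>n. op_poly (p n) A) \<longlonglongrightarrow> cfc f A"
proof -
  have near: "\<exists>N. \<forall>m\<ge>N. \<forall>n\<ge>N. norm (op_poly (q m) A - op_poly (q' n) A) < e"
    if q: "uniform_limit (real_spectrum A) (\<lambda>n. poly (q n)) f sequentially"
      and q': "uniform_limit (real_spectrum A) (\<lambda>n. poly (q' n)) f sequentially"
      and "0 < e" for q q' e
  proof -
    \<comment> \<open>Quarters, since \<open>op_poly_norm_le\<close> gives only the weak bound
      \<open>e / 2\<close>, which is then strictly below \<open>e\<close>.\<close>
    have "0 < e / 4" using \<open>0 < e\<close> by simp
    then have "\<forall>\<^sub>F n in sequentially. (\<forall>t\<in>real_spectrum A. dist (poly (q n) t) (f t) < e / 4)
        \<and> (\<forall>t\<in>real_spectrum A. dist (poly (q' n) t) (f t) < e / 4)"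
      by (intro eventually_conj uniform_limitD[OF q] uniform_limitD[OF q'])
    then obtain N where N: "\<And>n t. N \<le> n \<Longrightarrow> t \<in> real_spectrum A \<Longrightarrow>
        \<bar>poly (q n) t - f t\<bar> < e / 4 \<and> \<bar>poly (q' n) t - f t\<bar> < e / 4"
      unfolding eventually_sequentially dist_real_def by blast
    have "norm (op_poly (q m - q' n) A) \<le> e / 2" if "N \<le> m" "N \<le> n" for m n
    proof (rule op_poly_norm_le[OF A])
      fix t assume "t \<in> real_spectrum A"
      with N[OF that(1)] N[OF that(2)]
      have "\<bar>poly (q m) t - f t\<bar> < e / 4" "\<bar>poly (q' n) t - f t\<bar> < e / 4" by auto
      then show "\<bar>poly (q m - q' n) t\<bar> \<le> e / 2" unfolding poly_diff by linarith
    qed (use \<open>0 < e\<close> in simp)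
    moreover have "e / 2 < e" using \<open>0 < e\<close> by simp
    ultimately show ?thesis unfolding op_poly_diff by (meson le_less_trans)
  qed
  have "Cauchy (\<lambda>n. op_poly (p n) A)"
    by (intro CauchyI near p)
  then obtain T where T: "(\<lambda>n. op_poly (p n) A) \<longlonglongrightarrow> T"
    using Cauchy_convergent_iff convergent_def by blast
  have "cfc f A = T"
    unfolding cfc_def real_spectrum_def[symmetric]
  proof (rule the_equality)
    show "\<exists>p. uniform_limit (real_spectrum A) (\<lambda>n. poly (p n)) f sequentially \<and>
        (\<lambda>n. op_poly (p n) A) \<longlonglongrightarrow> T"
      using p T by blast
  next
    fix T'
    assume "\<exists>p. uniform_limit (real_spectrum A) (\<lambda>n. poly (p n)) f sequentially \<and>
        (\<lambda>n. op_poly (p n) A) \<longlonglongrightarrow> T'"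
    then obtain q where q: "uniform_limit (real_spectrum A) (\<lambda>n. poly (q n)) f sequentially"
      and T': "(\<lambda>n. op_poly (q n) A) \<longlonglongrightarrow> T'" by blast
    have "(\<lambda>n. op_poly (q n) A - op_poly (p n) A) \<longlonglongrightarrow> 0"
      by (rule LIMSEQ_I) (metis near[OF q p] diff_zero)
    moreover have "(\<lambda>n. op_poly (q n) A - op_poly (p n) A) \<longlonglongrightarrow> T' - T"
      by (intro tendsto_diff T T')
    ultimately show "T' = T" using LIMSEQ_unique by fastforce
  qed
  with T show ?thesis by simp
qed

text \<open>Weierstrass approximation as a sequence, the form that \<open>cfc\<close> uses: the
  \<open>n\<close>-th polynomial is within \<open>1 / (n + 1)\<close> of \<open>f\<close>.\<close>

lemma uniform_limit_poly:
  fixes f :: "real \<Rightarrow> real"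
  assumes f: "continuous_on S f" and S: "compact S"
  obtains p where "uniform_limit S (\<lambda>n. poly (p n)) f sequentially"
proof -
  have "\<exists>g. (\<exists>q. g = poly q) \<and> (\<forall>t\<in>S. \<bar>f t - g t\<bar> < e)" if "0 < e" for e :: real
  proof (rule Stone_Weierstrass_HOL[OF S _ _ _ _ _ f that])
    show "\<exists>q. (\<lambda>x. c) = poly q" for c :: real by (rule exI[of _ "[:c:]"]) auto
    show "continuous_on S g" if "\<exists>q. g = poly q" for g
      using that by (auto intro: continuous_intros)
    show "\<exists>q. (\<lambda>x. f x + g x) = poly q" if "(\<exists>q. f = poly q) \<and> (\<exists>q. g = poly q)"
      for f g :: "real \<Rightarrow> real"
      using that by (auto simp flip: poly_add)
    show "\<exists>q. (\<lambda>x. f x * g x) = poly q" if "(\<exists>q. f = poly q) \<and> (\<exists>q. g = poly q)"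
      for f g :: "real \<Rightarrow> real"
      using that by (auto simp flip: poly_mult)
    show "\<exists>g. (\<exists>q. g = poly q) \<and> g x \<noteq> g y" if "x \<in> S \<and> y \<in> S \<and> x \<noteq> y" for x y
      using that by (intro exI[of _ "poly [:0, 1:]"]) auto
  qed
  then have "\<exists>q. \<forall>t\<in>S. \<bar>f t - poly q t\<bar> < e" if "0 < e" for e :: real
    using that by blast
  then have "\<forall>n. \<exists>q. \<forall>t\<in>S. \<bar>f t - poly q t\<bar> < inverse (real (Suc n))"
    by simp
  then obtain p where p: "\<And>n t. t \<in> S \<Longrightarrow> \<bar>f t - poly (p n) t\<bar> < inverse (real (Suc n))"
    by metis
  have "uniform_limit S (\<lambda>n. poly (p n)) f sequentially"
  proof (rule uniform_limitI)
    fix e :: real assume "0 < e"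
    then have "\<forall>\<^sub>F n in sequentially. inverse (real (Suc n)) < e"
      using LIMSEQ_inverse_real_of_nat by (rule order_tendstoD(2)[rotated])
    then show "\<forall>\<^sub>F n in sequentially. \<forall>t\<in>S. dist (poly (p n) t) (f t) < e"
    proof eventually_elim
      case (elim n)
      then show ?case using p less_trans by (fastforce simp: dist_real_def abs_minus_commute)
    qed
  qed
  then show thesis by (rule that)
qed

text \<open>The interval contains the spectrum, so continuity and approximation on it are enough and
  the spectrum need not be determined. The main proof uses the locale for \<open>A\<close> and for
  \<open>X\<close>.\<close>

locale op_interval =
  fixes A :: "'a::chilbert_space \<Rightarrow>\<^sub>L 'a" and a b :: real
  assumes lower: "A \<succeq> a *\<^sub>R id_blinfun" and upper: "b *\<^sub>R id_blinfun \<succeq> A"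
begin

lemma selfadjoint: "selfadjoint_op A"
  using lower by (simp add: op_ge_iff)

text \<open>For \<open>t < a\<close> the operator \<open>A - t\<close> is coercive with constant
  \<open>a - t\<close>; for \<open>t > b\<close> so is \<open>t - A\<close> with constant
  \<open>t - b\<close>.\<close>

lemma real_spectrum_subset: "real_spectrum A \<subseteq> {a..b}"
proof
  fix t assume t: "t \<in> real_spectrum A"
  have form: "a * (norm x)\<^sup>2 \<le> re_inner x (blinfun_apply A x)"
    "re_inner x (blinfun_apply A x) \<le> b * (norm x)\<^sup>2" for x
    using lower upper
    by (simp_all add: op_ge_iff blinfun_simps re_inner.scaleR_right re_inner_self)
  have "a \<le> t"
  proof (rule ccontr)
    assume "\<not> a \<le> t"
    then have "invertible_op (A - t *\<^sub>R id_blinfun)"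
      using form(1)
      by (intro invertible_op_coercive[where d = "a - t"])
        (auto intro!: selfadjoint_op_closure selfadjoint selfadjoint_op_id simp: blinfun_simps
          re_inner.diff_right re_inner.scaleR_right re_inner_self left_diff_distrib)
    with t show False by (simp add: real_spectrum_iff)
  qed
  moreover have "t \<le> b"
  proof (rule ccontr)
    assume "\<not> t \<le> b"
    then have "invertible_op (t *\<^sub>R id_blinfun - A)"
      using form(2)
      by (intro invertible_op_coercive[where d = "t - b"])
        (auto intro!: selfadjoint_op_closure selfadjoint selfadjoint_op_id simp: blinfun_simps
          re_inner.diff_right re_inner.scaleR_right re_inner_self left_diff_distrib)
    then have "invertible_op (A - t *\<^sub>R id_blinfun)"
      using invertible_op_uminus by fastforce
    with t show False by (simp add: real_spectrum_iff)
  qed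
  ultimately show "t \<in> {a..b}" by simp
qed

lemma cfc_limit_on:
  assumes "uniform_limit {a..b} (\<lambda>n. poly (p n)) f sequentially"
  shows "(\<lambda>n. op_poly (p n) A) \<longlonglongrightarrow> cfc f A"
  using assms real_spectrum_subset
  by (intro cfc_limit selfadjoint) (rule uniform_limit_on_subset)

lemma cfc_poly: "cfc (poly p) A = op_poly p A"
  by (rule LIMSEQ_unique[OF cfc_limit_on tendsto_const]) (simp add: uniform_limit_const)

text \<open>Used to simplify powers, since identities such as \<open>t powr 0 = 1\<close> fail at
  \<open>t = 0\<close>.\<close>

lemma cfc_cong:
  assumes "\<And>t. t \<in> {a..b} \<Longrightarrow> f t = g t"
  shows "cfc f A = cfc g A"
proof -
  have "uniform_limit (real_spectrum A) p f sequentially \<longleftrightarrow>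
      uniform_limit (real_spectrum A) p g sequentially" for p :: "nat \<Rightarrow> real \<Rightarrow> real"
    using assms real_spectrum_subset by (intro uniform_limit_cong') auto
  then show ?thesis by (simp add: cfc_def real_spectrum_def)
qed

lemma selfadjoint_cfc:
  assumes "continuous_on {a..b} f"
  shows "selfadjoint_op (cfc f A)"
proof -
  obtain p where "uniform_limit {a..b} (\<lambda>n. poly (p n)) f sequentially"
    using uniform_limit_poly[OF assms compact_Icc] by blast
  then show ?thesis
    using selfadjoint_op_limit[OF cfc_limit_on] selfadjoint_op_poly[OF selfadjoint] by blast
qed

lemma cfc_add:
  assumes f: "continuous_on {a..b} f" and g: "continuous_on {a..b} g"
  shows "cfc (\<lambda>t. f t + g t) A = cfc f A + cfc g A"
proof -
  obtain p q where p: "uniform_limit {a..b} (\<lambda>n. poly (p n)) f sequentially"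
    and q: "uniform_limit {a..b} (\<lambda>n. poly (q n)) g sequentially"
    using uniform_limit_poly[OF f compact_Icc] uniform_limit_poly[OF g compact_Icc] by metis
  have "(\<lambda>n. op_poly (p n + q n) A) \<longlonglongrightarrow> cfc (\<lambda>t. f t + g t) A"
    using uniform_limit_add[OF p q] by (intro cfc_limit_on) (simp add: poly_add[abs_def])
  moreover have "(\<lambda>n. op_poly (p n + q n) A) \<longlonglongrightarrow> cfc f A + cfc g A"
    unfolding op_poly_add by (intro tendsto_add cfc_limit_on p q)
  ultimately show ?thesis by (rule LIMSEQ_unique)
qed

lemma cfc_mult:
  assumes f: "continuous_on {a..b} f" and g: "continuous_on {a..b} g"
  shows "cfc (\<lambda>t. f t * g t) A = cfc f A o\<^sub>L cfc g A"
proof -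
  obtain p q where p: "uniform_limit {a..b} (\<lambda>n. poly (p n)) f sequentially"
    and q: "uniform_limit {a..b} (\<lambda>n. poly (q n)) g sequentially"
    using uniform_limit_poly[OF f compact_Icc] uniform_limit_poly[OF g compact_Icc] by metis
  have "bounded (f ` {a..b})" "bounded (g ` {a..b})"
    using compact_continuous_image[OF f compact_Icc] compact_continuous_image[OF g compact_Icc]
    by (auto intro: compact_imp_bounded)
  then have "(\<lambda>n. op_poly (p n * q n) A) \<longlonglongrightarrow> cfc (\<lambda>t. f t * g t) A"
    using uniform_lim_mult[OF p q] by (intro cfc_limit_on) (simp add: poly_mult[abs_def])
  moreover have "(\<lambda>n. op_poly (p n * q n) A) \<longlonglongrightarrow> (cfc f A o\<^sub>L cfc g A)"
    unfolding op_poly_mult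
    by (intro bounded_bilinear.tendsto[OF bounded_bilinear_blinfun_compose] cfc_limit_on p q)
  ultimately show ?thesis by (rule LIMSEQ_unique)
qed

lemma cfc_cmult:
  assumes "continuous_on {a..b} f"
  shows "cfc (\<lambda>t. c * f t) A = c *\<^sub>R cfc f A"
  using cfc_mult[of "poly [:c:]" f] assms cfc_poly[of "[:c:]"]
  by (simp add: compose_distribs compose_id)

text \<open>With \<open>R\<close> the value of the calculus at \<open>sqrt f\<close>, the operator
  \<open>R o\<^sub>L R\<close> has the form of a squared norm.\<close>

lemma positive_cfc:
  assumes f: "continuous_on {a..b} f" and nonneg: "\<And>t. t \<in> {a..b} \<Longrightarrow> 0 \<le> f t"
  shows "positive_op (cfc f A)"
proof -
  define R where "R = cfc (\<lambda>t. sqrt (f t)) A"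
  have cont: "continuous_on {a..b} (\<lambda>t. sqrt (f t))" using f by (intro continuous_intros)
  have "cfc f A = R o\<^sub>L R"
    unfolding R_def cfc_mult[OF cont cont, symmetric] using nonneg by (intro cfc_cong) simp
  moreover have R: "selfadjoint_op R" unfolding R_def by (rule selfadjoint_cfc[OF cont])
  ultimately show ?thesis
    by (simp add: positive_op_iff selfadjoint_op_closure re_inner_self
        selfadjoint_opD[OF R, symmetric])
qed

end

section \<open>The scalar inequality\<close>

text \<open>The power in Specht's ratio is \<open>exp a\<close>, with logarithm
  \<open>a\<close>.\<close>

lemma specht_ratio_eq:
  assumes "1 < k"
  defines "a \<equiv> ln k / (k - 1)"
  shows "specht_ratio k = exp (a - 1) / a"
proof -
  have "k powr (1 / (k - 1)) = exp a" using assms by (simp add: powr_def)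
  then show ?thesis by (simp add: specht_ratio_def exp_diff)
qed

text \<open>With \<open>a = ln k / (k - 1)\<close> the slope of the chord of \<open>ln\<close> over \<open>{1..k}\<close> and
  \<open>y = 1 - \<mu> + \<mu> u\<close>, the bound \<open>a y \<le> exp (a y - 1)\<close> together with \<open>a (u - 1) \<le> ln u\<close> gives the
  claim. The symmetry \<open>u \<mapsto> 1 / u\<close>, \<open>\<mu> \<mapsto> 1 - \<mu>\<close> then extends it to \<open>1 / k \<le> u\<close>.\<close>

lemma reverse_Young_ge_1:
  assumes k: "1 < k" and u: "1 \<le> u" "u \<le> k" and \<mu>: "0 \<le> \<mu>"
  shows "1 - \<mu> + \<mu> * u \<le> specht_ratio k * u powr \<mu>"
proof -
  define a where "a = ln k / (k - 1)"
  have a: "0 < a" using k by (simp add: a_def)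
  \<comment> \<open>The weight that makes \<open>u\<close> a convex combination of 1 and
    \<open>k\<close>.\<close>
  define \<theta> where "\<theta> = (u - 1) / (k - 1)"
  have \<theta>: "0 \<le> \<theta>" "\<theta> \<le> 1" using k u by (simp_all add: \<theta>_def)
  have "(1 - \<theta>) * ln 1 + \<theta> * ln k \<le> ln ((1 - \<theta>) * 1 + \<theta> * k)"
    using concave_onD[OF ln_concave \<theta>, of 1 k] k by simp
  also have "(1 - \<theta>) * 1 + \<theta> * k = u"
  proof -
    have "\<theta> * (k - 1) = u - 1" using k by (simp add: \<theta>_def)
    then show ?thesis by (simp add: algebra_simps)
  qed
  finally have chord: "a * (u - 1) \<le> ln u" by (simp add: a_def \<theta>_def mult.commute)
  define y where "y = 1 - \<mu> + \<mu> * u"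
  have "a * y = a + \<mu> * (a * (u - 1))" by (simp add: y_def algebra_simps)
  also have "\<dots> \<le> a + \<mu> * ln u" using chord \<mu> by (intro add_left_mono mult_left_mono)
  finally have "a * y \<le> a + \<mu> * ln u" .
  moreover have "a * y \<le> exp (a * y - 1)" using exp_ge_add_one_self[of "a * y - 1"] by simp
  ultimately have "a * y \<le> exp ((a - 1) + \<mu> * ln u)"
    by (smt (verit) exp_le_cancel_iff)
  also have "\<dots> = exp (a - 1) * u powr \<mu>"
    using u by (simp add: powr_def flip: exp_add)
  finally have "y \<le> exp (a - 1) / a * u powr \<mu>" using a by (simp add: field_simps)
  then show ?thesis using k by (simp add: specht_ratio_eq a_def y_def)
qed

lemma reverse_Young:
  assumes k: "1 < k" and u: "1 / k \<le> u" "u \<le> k" and \<mu>: "0 \<le> \<mu>" "\<mu> \<le> 1"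
  shows "1 - \<mu> + \<mu> * u \<le> specht_ratio k * u powr \<mu>"
proof (cases "1 \<le> u")
  case False
  have "0 < 1 / k" using k by simp
  then have "0 < u" using u(1) by (rule less_le_trans)
  have "1 - (1 - \<mu>) + (1 - \<mu>) * (1 / u) \<le> specht_ratio k * (1 / u) powr (1 - \<mu>)"
    using False u k \<mu> \<open>0 < u\<close> by (intro reverse_Young_ge_1) (auto simp: field_simps)
  \<comment> \<open>Multiplying the instance at \<open>1 / u\<close> and \<open>1 - \<mu>\<close> by
    \<open>u\<close> restores both sides of the claim.\<close>
  then have "u * (1 - (1 - \<mu>) + (1 - \<mu>) * (1 / u)) \<le> u * (specht_ratio k * (1 / u) powr (1 - \<mu>))"
    using \<open>0 < u\<close> by (intro mult_left_mono) auto
  moreover have "u * (1 - (1 - \<mu>) + (1 - \<mu>) * (1 / u)) = 1 - \<mu> + \<mu> * u"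
    using \<open>0 < u\<close> by (simp add: field_simps)
  moreover have "u * (1 / u) powr (1 - \<mu>) = u powr \<mu>"
    using \<open>0 < u\<close> by (simp add: powr_divide powr_diff)
  ultimately show ?thesis by (simp add: mult.left_commute[of u])
qed (use assms reverse_Young_ge_1 in auto)

lemma refined_reverse_Young:
  assumes h: "1 < h" and t: "1 / h \<le> t" "t \<le> h" and \<nu>: "0 \<le> \<nu>" "\<nu> \<le> 1"
    and r: "r = min \<nu> (1 - \<nu>)"
  shows "(1 - \<nu>) + \<nu> * t - 2 * r * ((1 + t) / 2 - t powr (1/2)) \<le> specht_ratio (sqrt h) * t powr \<nu>"
proof -
  have "0 < 1 / h" using h by simp
  then have "0 < t" using t(1) by (rule less_le_trans)
  define u where "u = sqrt t"
  have u: "0 < u" "t = u * u" using \<open>0 < t\<close> by (simp_all add: u_def)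
  have tp: "t powr s = u powr (2 * s)" for s
    using u(1) by (simp add: u(2) powr_mult flip: powr_add)
  \<comment> \<open>The passage to the square root is why Specht's ratio is taken at
    \<open>sqrt h\<close>.\<close>
  have range: "1 < sqrt h" "1 / sqrt h \<le> u" "u \<le> sqrt h"
    using h t real_sqrt_le_mono[OF t(1)] by (simp_all add: u_def real_sqrt_divide)
  show ?thesis
  proof (cases "\<nu> \<le> 1/2")
    case True
    then have "1 - 2 * \<nu> + 2 * \<nu> * u \<le> specht_ratio (sqrt h) * u powr (2 * \<nu>)"
      using range \<nu> by (intro reverse_Young) auto
    \<comment> \<open>With \<open>r = \<nu>\<close> the terms in \<open>t\<close> cancel, which
      leaves an expression affine in \<open>u\<close>.\<close>
    also have "1 - 2 * \<nu> + 2 * \<nu> * u = (1 - \<nu>) + \<nu> * t - 2 * \<nu> * ((1 + t) / 2 - u)"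
      by (simp add: field_simps)
    finally show ?thesis using True u(1) by (simp add: r tp)
  next
    case False
    then have "1 - (2 * \<nu> - 1) + (2 * \<nu> - 1) * u \<le> specht_ratio (sqrt h) * u powr (2 * \<nu> - 1)"
      using range \<nu> by (intro reverse_Young) auto
    then have "u * (1 - (2 * \<nu> - 1) + (2 * \<nu> - 1) * u) \<le>
        u * (specht_ratio (sqrt h) * u powr (2 * \<nu> - 1))"
      using u by (intro mult_left_mono) auto
    also have "u * (specht_ratio (sqrt h) * u powr (2 * \<nu> - 1)) =
        specht_ratio (sqrt h) * u powr (2 * \<nu>)"
      using u(1) by (simp add: powr_diff)
    \<comment> \<open>With \<open>r = 1 - \<nu>\<close> the constant terms cancel instead, which
      leaves a common factor \<open>u\<close>.\<close>
    also have "u * (1 - (2 * \<nu> - 1) + (2 * \<nu> - 1) * u) =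
        (1 - \<nu>) + \<nu> * t - 2 * (1 - \<nu>) * ((1 + t) / 2 - u)"
      by (simp add: u(2) field_simps)
    finally show ?thesis using False u(1) by (simp add: r tp)
  qed
qed

section \<open>The operator inequality\<close>

lemma continuous_on_powr_pos:
  fixes a :: real
  assumes "0 < a"
  shows "continuous_on {a..b} (\<lambda>t. t powr s)"
  using assms by (intro continuous_intros) auto

theorem theorem3p3:
  fixes A B :: "'a::chilbert_space \<Rightarrow>\<^sub>L 'a"
    and m M h \<nu> r :: real
  assumes "positive_op A" and "invertible_op A"
    and "positive_op B" and "invertible_op B"
    and "0 < m"
    and "A \<succeq> m *\<^sub>R id_blinfun" and "M *\<^sub>R id_blinfun \<succeq> A"
    and "B \<succeq> m *\<^sub>R id_blinfun" and "M *\<^sub>R id_blinfun \<succeq> B"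
    and "h = M / m" and "1 < h"
    and "\<nu> \<in> {0..1}" and "r = min \<nu> (1 - \<nu>)"
  shows "specht_ratio (sqrt h) *\<^sub>R geom_mean \<nu> A B \<succeq>
    (1 - \<nu>) *\<^sub>R A + \<nu> *\<^sub>R B - (2 * r) *\<^sub>R ((1/2) *\<^sub>R (A + B) - geom_mean (1/2) A B)"
proof -
  have "M = h * m" using assms(5,10) by simp
  \<comment> \<open>Positivity of \<open>M\<close> is taken from \<open>h > 1\<close>, as the
    operator bounds say nothing on the trivial space.\<close>
  then have M: "0 < M" using assms(5,11) by simp
  have B: "selfadjoint_op B" using assms(3) by (simp add: positive_op_iff)
  interpret A: op_interval A m M using assms(6,7) by unfold_locales
  note powrA = continuous_on_powr_pos[OF \<open>0 < m\<close>, of M]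

  \<comment> \<open>The square root of \<open>A\<close> and its inverse\<close>
  define P where "P = op_powr A (1/2)"
  define Q where "Q = op_powr A (-1/2)"
  have compose: "op_powr A s o\<^sub>L op_powr A s' = op_powr A (s + s')" for s s'
    unfolding op_powr_def A.cfc_mult[OF powrA powrA, symmetric] by (simp add: powr_add)
  have powr_0: "op_powr A 0 = id_blinfun"
  proof -
    have "op_powr A 0 = cfc (poly 1) A"
      unfolding op_powr_def using \<open>0 < m\<close> by (intro A.cfc_cong) auto
    then show ?thesis by (simp add: A.cfc_poly one_pCons)
  qed
  have PQ: "P o\<^sub>L Q = id_blinfun" "Q o\<^sub>L P = id_blinfun"
    by (simp_all add: P_def Q_def compose powr_0)
  have PP: "P o\<^sub>L P = A"
  proof -
    have "P o\<^sub>L P = cfc (poly [:0, 1:]) A"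
      unfolding P_def compose unfolding op_powr_def using \<open>0 < m\<close> by (intro A.cfc_cong) auto
    then show ?thesis by (simp add: A.cfc_poly compose_id)
  qed
  have P: "selfadjoint_op P" and Q: "selfadjoint_op Q"
    unfolding P_def Q_def op_powr_def by (rule A.selfadjoint_cfc[OF powrA])+

  \<comment> \<open>Bounds on the inverse square root\<close>
  have QQ: "Q o\<^sub>L Q = cfc (\<lambda>t. 1 / t) A"
    unfolding Q_def compose unfolding op_powr_def using \<open>0 < m\<close>
    by (intro A.cfc_cong) (simp add: powr_minus_divide)
  have inverse_cont: "continuous_on {m..M} (\<lambda>t. c / t)" for c
    using \<open>0 < m\<close> by (intro continuous_intros) auto
  have Q_lower: "(norm x)\<^sup>2 / M \<le> (norm (blinfun_apply Q x))\<^sup>2" for x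
  proof -
    \<comment> \<open>On \<open>{m..M}\<close> the function \<open>1 / t - 1 / M\<close> is
      nonnegative. The constant is written as a polynomial so that \<open>cfc_poly\<close> evaluates
      it.\<close>
    have "positive_op (cfc (\<lambda>t. 1 / t + poly [:- 1 / M:] t) A)"
      using \<open>0 < m\<close> M by (intro A.positive_cfc continuous_on_add inverse_cont)
        (auto intro: continuous_intros simp: field_simps)
    also have "cfc (\<lambda>t. 1 / t + poly [:- 1 / M:] t) A = (Q o\<^sub>L Q) - (1 / M) *\<^sub>R id_blinfun"
      by (subst A.cfc_add[OF inverse_cont])
        (auto intro: continuous_intros simp: A.cfc_poly QQ)
    finally show ?thesis
      by (simp add: positive_op_iff blinfun.diff_left blinfun.scaleR_left re_inner.diff_right
          re_inner.scaleR_right re_inner_self selfadjoint_opD[OF Q, symmetric])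
  qed
  have Q_upper: "(norm (blinfun_apply Q x))\<^sup>2 \<le> (norm x)\<^sup>2 / m" for x
  proof -
    have "positive_op (cfc (\<lambda>t. - 1 / t + poly [:1 / m:] t) A)"
      using \<open>0 < m\<close> M by (intro A.positive_cfc continuous_on_add inverse_cont)
        (auto intro: continuous_intros simp: field_simps)
    also have "cfc (\<lambda>t. - 1 / t + poly [:1 / m:] t) A = (1 / m) *\<^sub>R id_blinfun - (Q o\<^sub>L Q)"
      using A.cfc_cmult[OF inverse_cont[of 1], of "-1"]
      by (subst A.cfc_add[OF inverse_cont])
        (auto intro: continuous_intros simp: A.cfc_poly QQ minus_divide_left
          simp del: divide_minus_left)
    finally show ?thesis
      by (simp add: positive_op_iff blinfun.diff_left blinfun.scaleR_left re_inner.diff_right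
          re_inner.scaleR_right re_inner_self selfadjoint_opD[OF Q, symmetric])
  qed

  \<comment> \<open>The operator \<open>X\<close> and its bounds\<close>
  define X where "X = Q o\<^sub>L B o\<^sub>L Q"
  have X: "selfadjoint_op X" unfolding X_def using B Q by (intro selfadjoint_op_closure)
  have X_form: "re_inner x (blinfun_apply X x) =
      re_inner (blinfun_apply Q x) (blinfun_apply B (blinfun_apply Q x))" for x
    by (simp add: X_def selfadjoint_opD[OF Q, symmetric])
  have B_form: "m * (norm x)\<^sup>2 \<le> re_inner x (blinfun_apply B x)"
    "re_inner x (blinfun_apply B x) \<le> M * (norm x)\<^sup>2" for x
    using assms(8,9) by (simp_all add: op_ge_iff blinfun_simps re_inner.scaleR_right re_inner_self)
  interpret X: op_interval X "1 / h" h
  proof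
    \<comment> \<open>The bound \<open>m\<close> for \<open>B\<close> at \<open>Q x\<close> and
      \<open>1 / M\<close> for the square of \<open>Q\<close> multiply to
      \<open>m / M = 1 / h\<close>; likewise \<open>M\<close> and \<open>1 / m\<close> give the
      upper bound \<open>h\<close>.\<close>
    have "(1 / h) * (norm x)\<^sup>2 \<le> re_inner x (blinfun_apply X x)" for x
    proof -
      have "(1 / h) * (norm x)\<^sup>2 = m * ((norm x)\<^sup>2 / M)" by (simp add: assms(10))
      also have "\<dots> \<le> m * (norm (blinfun_apply Q x))\<^sup>2"
        using Q_lower \<open>0 < m\<close> by (intro mult_left_mono) auto
      finally show ?thesis unfolding X_form using B_form(1) by (rule order_trans)
    qed
    then show "X \<succeq> (1 / h) *\<^sub>R id_blinfun"
      using X selfadjoint_op_closure(3)[OF selfadjoint_op_id]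
      by (simp add: op_ge_iff blinfun_simps re_inner.scaleR_right re_inner_self)
    have "re_inner x (blinfun_apply X x) \<le> h * (norm x)\<^sup>2" for x
    proof -
      have "M * (norm (blinfun_apply Q x))\<^sup>2 \<le> M * ((norm x)\<^sup>2 / m)"
        using Q_upper M by (intro mult_left_mono) auto
      also have "\<dots> = h * (norm x)\<^sup>2" by (simp add: assms(10))
      finally show ?thesis unfolding X_form using B_form(2) by (rule order_trans[rotated])
    qed
    then show "h *\<^sub>R id_blinfun \<succeq> X"
      using X selfadjoint_op_closure(3)[OF selfadjoint_op_id]
      by (simp add: op_ge_iff blinfun_simps re_inner.scaleR_right re_inner_self)
  qed
  have "0 < 1 / h" using assms(11) by simp
  note powrX = continuous_on_powr_pos[OF this, of h]

  \<comment> \<open>The scalar inequality at \<open>X\<close>, conjugated by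
    \<open>P\<close>\<close>
  define S where "S = specht_ratio (sqrt h)"
  define L where "L = [:r - (1 - \<nu>), r - \<nu>:]"
  \<comment> \<open>The right side minus the left side of \<open>refined_reverse_Young\<close>,
    split into powers, which become geometric means, and the affine part \<open>L\<close>.\<close>
  define f where "f t = S * t powr \<nu> + (- (2 * r) * t powr (1/2) + poly L t)" for t
  have cont: "continuous_on {1 / h..h} (\<lambda>t. S * t powr \<nu>)"
    "continuous_on {1 / h..h} (\<lambda>t. - (2 * r) * t powr (1/2))"
    "continuous_on {1 / h..h} (poly L)"
    by (intro continuous_on_mult powrX continuous_on_const continuous_on_poly continuous_on_id)+
  have "positive_op (cfc f X)"
  proof (rule X.positive_cfc)
    show "continuous_on {1 / h..h} f"
      unfolding f_def by (intro continuous_on_add cont)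
    show "0 \<le> f t" if "t \<in> {1 / h..h}" for t
      using refined_reverse_Young[OF assms(11), of t \<nu> r] that assms(12,13)
      by (simp add: f_def L_def S_def field_simps)
  qed
  also have "cfc f X = S *\<^sub>R op_powr X \<nu> - (2 * r) *\<^sub>R op_powr X (1/2) +
      (r - (1 - \<nu>)) *\<^sub>R id_blinfun + (r - \<nu>) *\<^sub>R X"
    unfolding f_def op_powr_def
      X.cfc_add[OF cont(1) continuous_on_add[OF cont(2,3)]] X.cfc_add[OF cont(2,3)]
      X.cfc_cmult[OF powrX] X.cfc_poly
    by (simp add: L_def compose_distribs compose_id)
  finally have "positive_op (S *\<^sub>R op_powr X \<nu> - (2 * r) *\<^sub>R op_powr X (1/2) +
      (r - (1 - \<nu>)) *\<^sub>R id_blinfun + (r - \<nu>) *\<^sub>R X)" (is "positive_op ?Y") .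
  then have PYP: "positive_op (P o\<^sub>L ?Y o\<^sub>L P)"
    using P by (simp add: positive_op_iff selfadjoint_op_closure selfadjoint_opD[OF P, symmetric])
  have PXP: "P o\<^sub>L X o\<^sub>L P = B"
  proof -
    have "P o\<^sub>L X o\<^sub>L P = (P o\<^sub>L Q) o\<^sub>L B o\<^sub>L (Q o\<^sub>L P)"
      by (simp add: X_def compose_assoc)
    then show ?thesis by (simp add: PQ compose_id)
  qed
  have G: "geom_mean s A B = P o\<^sub>L op_powr X s o\<^sub>L P" for s
    by (simp add: geom_mean_def P_def Q_def X_def)
  \<comment> \<open>Conjugation sends the identity to \<open>A\<close>, \<open>X\<close> to
    \<open>B\<close> and the powers of \<open>X\<close> to geometric means.\<close>
  have "P o\<^sub>L ?Y o\<^sub>L P = S *\<^sub>R geom_mean \<nu> A B - (2 * r) *\<^sub>R geom_mean (1/2) A B +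
      (r - (1 - \<nu>)) *\<^sub>R A + (r - \<nu>) *\<^sub>R B"
    by (simp only: compose_distribs compose_id PP PXP G)
  also have "\<dots> = S *\<^sub>R geom_mean \<nu> A B - ((1 - \<nu>) *\<^sub>R A + \<nu> *\<^sub>R B -
      (2 * r) *\<^sub>R ((1/2) *\<^sub>R (A + B) - geom_mean (1/2) A B))"
    by (simp add: algebra_simps)
  finally have diff: "positive_op (S *\<^sub>R geom_mean \<nu> A B - ((1 - \<nu>) *\<^sub>R A + \<nu> *\<^sub>R B -
      (2 * r) *\<^sub>R ((1/2) *\<^sub>R (A + B) - geom_mean (1/2) A B)))"
    using PYP by simp
  have "selfadjoint_op (geom_mean s A B)" for s
    unfolding G unfolding op_powr_def by (intro selfadjoint_op_closure P X.selfadjoint_cfc powrX)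
  with diff show ?thesis
    unfolding op_ge_def S_def
    by (intro conjI selfadjoint_op_closure A.selfadjoint B)
qed

end
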